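(* The semiring maps $\mathbb{N} \to \mathbb{Z}$ and $\mathbb{R}_{+} \to \mathbb{R}$ are not flat; that is, $\mathbb{Z}$ is not a flat $\mathbb{N}$-module and $\mathbb{R}$ is not a flat $\mathbb{R}_{+}$-module.
   Context: Semirings are commutative, with $0$ and $1$. $\mathbb{N}$ is the semiring of natural numbers including $0$; $\mathbb{R}_{+}$ is the semiring of non-negative real numbers with usual addition and multiplication. For a semiring $A$, an $A$-module is a commutative monoid with a (bi-additive, unital, associative, zero-preserving) action of $A$; $A\text{-mod}$ is the category of $A$-modules with tensor product $\otimes_A$. An $A$-module $M$ is flat if the functor $-\otimes_A M: A\text{-mod}\to A\text{-mod}$ preserves finite limits. A semiring map $A\to B$ is flat if $B$ is flat as an $A$-module. *)

theory Defs
  imports Complex_Main "HOL-Library.Multiset" "HOL-Algebra.Module" "HOL-Algebra.IntRing"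
begin

section \<open>Commutative semirings and their modules\<close>

locale csemiring = semiring R + comm_monoid R for R (structure)

text \<open>A set closed under the operations of a type class, as a structure with carrier.\<close>

definition semiring_on :: "'a::comm_semiring_1 set \<Rightarrow> 'a ring" where
  "semiring_on S = \<lparr>carrier = S, monoid.mult = (*), one = 1, zero = 0, add = (+)\<rparr>"

definition nat_semiring :: "nat ring" where
  "nat_semiring = semiring_on UNIV"

definition nonneg_real_semiring :: "real ring" where
  "nonneg_real_semiring = semiring_on {x. 0 \<le> x}"

definition real_semiring :: "real ring" where
  "real_semiring = semiring_on UNIV"

text \<open>The library's \<open>ring_hom\<close> does not ask for preservation of zero, which is not automatic
  without additive inverses.\<close>

definition semiring_hom ::
    "('a, 'r) ring_scheme \<Rightarrow> ('b, 's) ring_scheme \<Rightarrow> ('a \<Rightarrow> 'b) set" where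
  "semiring_hom A B = {f \<in> ring_hom A B. f \<zero>\<^bsub>A\<^esub> = \<zero>\<^bsub>B\<^esub>}"

text \<open>Modules use the library record \<open>module\<close>, whose fields \<open>mult\<close> and \<open>one\<close> play no role,
  exactly as in the library locale \<open>module\<close>.\<close>

locale semimodule = R?: csemiring R + M?: abelian_monoid M
  for R (structure) and M (structure) +
  assumes smult_closed:
      "\<lbrakk>a \<in> carrier R; x \<in> carrier M\<rbrakk> \<Longrightarrow> a \<odot>\<^bsub>M\<^esub> x \<in> carrier M"
    and smult_l_distr:
      "\<lbrakk>a \<in> carrier R; b \<in> carrier R; x \<in> carrier M\<rbrakk>
        \<Longrightarrow> (a \<oplus>\<^bsub>R\<^esub> b) \<odot>\<^bsub>M\<^esub> x = a \<odot>\<^bsub>M\<^esub> x \<oplus>\<^bsub>M\<^esub> b \<odot>\<^bsub>M\<^esub> x"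
    and smult_r_distr:
      "\<lbrakk>a \<in> carrier R; x \<in> carrier M; y \<in> carrier M\<rbrakk>
        \<Longrightarrow> a \<odot>\<^bsub>M\<^esub> (x \<oplus>\<^bsub>M\<^esub> y) = a \<odot>\<^bsub>M\<^esub> x \<oplus>\<^bsub>M\<^esub> a \<odot>\<^bsub>M\<^esub> y"
    and smult_assoc:
      "\<lbrakk>a \<in> carrier R; b \<in> carrier R; x \<in> carrier M\<rbrakk>
        \<Longrightarrow> (a \<otimes>\<^bsub>R\<^esub> b) \<odot>\<^bsub>M\<^esub> x = a \<odot>\<^bsub>M\<^esub> (b \<odot>\<^bsub>M\<^esub> x)"
    and smult_one: "x \<in> carrier M \<Longrightarrow> \<one>\<^bsub>R\<^esub> \<odot>\<^bsub>M\<^esub> x = x"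
    and smult_l_null: "x \<in> carrier M \<Longrightarrow> \<zero>\<^bsub>R\<^esub> \<odot>\<^bsub>M\<^esub> x = \<zero>\<^bsub>M\<^esub>"
    and smult_r_null: "a \<in> carrier R \<Longrightarrow> a \<odot>\<^bsub>M\<^esub> \<zero>\<^bsub>M\<^esub> = \<zero>\<^bsub>M\<^esub>"

text \<open>Homomorphisms are extensional functions, so that equality of arrows is equality in HOL;
  accordingly arrows are composed with \<open>compose\<close>, and the identity is a restriction.\<close>

definition semimodule_hom ::
    "('a, 'r) ring_scheme \<Rightarrow> ('a, 'm, 's) module_scheme \<Rightarrow> ('a, 'n, 't) module_scheme
      \<Rightarrow> ('m \<Rightarrow> 'n) set" where
  "semimodule_hom A M N =
    {h \<in> carrier M \<rightarrow>\<^sub>E carrier N.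
      h \<zero>\<^bsub>M\<^esub> = \<zero>\<^bsub>N\<^esub> \<and>
      (\<forall>x\<in>carrier M. \<forall>y\<in>carrier M. h (x \<oplus>\<^bsub>M\<^esub> y) = h x \<oplus>\<^bsub>N\<^esub> h y) \<and>
      (\<forall>a\<in>carrier A. \<forall>x\<in>carrier M. h (a \<odot>\<^bsub>M\<^esub> x) = a \<odot>\<^bsub>N\<^esub> h x)}"

text \<open>The target of a semiring map, as a module over the source.\<close>

definition restrict_scalars ::
    "('b, 's) ring_scheme \<Rightarrow> ('a \<Rightarrow> 'b) \<Rightarrow> ('a, 'b) module" where
  "restrict_scalars B f =
    \<lparr>carrier = carrier B, monoid.mult = monoid.mult B, one = one B, zero = zero B, add = add B,
     smult = (\<lambda>a b. f a \<otimes>\<^bsub>B\<^esub> b)\<rparr>"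


section \<open>Tensor products\<close>

text \<open>The free commutative monoid on pairs, realised by finite multisets of pairs, is divided by
  the least congruence making the insertion of pairs bilinear over \<open>A\<close>.\<close>

inductive_set tensor_rel ::
    "('a, 'r) ring_scheme \<Rightarrow> ('a, 'n, 's) module_scheme \<Rightarrow> ('a, 'm, 't) module_scheme
      \<Rightarrow> (('n \<times> 'm) multiset \<times> ('n \<times> 'm) multiset) set"
  for A N M where
    add_left: "\<lbrakk>n \<in> carrier N; n' \<in> carrier N; m \<in> carrier M\<rbrakk>
      \<Longrightarrow> ({#(n \<oplus>\<^bsub>N\<^esub> n', m)#}, {#(n, m), (n', m)#}) \<in> tensor_rel A N M"
  | add_right: "\<lbrakk>n \<in> carrier N; m \<in> carrier M; m' \<in> carrier M\<rbrakk>
      \<Longrightarrow> ({#(n, m \<oplus>\<^bsub>M\<^esub> m')#}, {#(n, m), (n, m')#}) \<in> tensor_rel A N M"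
  | zero_left: "m \<in> carrier M \<Longrightarrow> ({#(\<zero>\<^bsub>N\<^esub>, m)#}, {#}) \<in> tensor_rel A N M"
  | zero_right: "n \<in> carrier N \<Longrightarrow> ({#(n, \<zero>\<^bsub>M\<^esub>)#}, {#}) \<in> tensor_rel A N M"
  | balanced: "\<lbrakk>a \<in> carrier A; n \<in> carrier N; m \<in> carrier M\<rbrakk>
      \<Longrightarrow> ({#(a \<odot>\<^bsub>N\<^esub> n, m)#}, {#(n, a \<odot>\<^bsub>M\<^esub> m)#}) \<in> tensor_rel A N M"
  | refl: "set_mset x \<subseteq> carrier N \<times> carrier M \<Longrightarrow> (x, x) \<in> tensor_rel A N M"
  | sym: "(x, y) \<in> tensor_rel A N M \<Longrightarrow> (y, x) \<in> tensor_rel A N M"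
  | trans: "\<lbrakk>(x, y) \<in> tensor_rel A N M; (y, z) \<in> tensor_rel A N M\<rbrakk>
      \<Longrightarrow> (x, z) \<in> tensor_rel A N M"
  | plus: "\<lbrakk>(x, y) \<in> tensor_rel A N M; (x', y') \<in> tensor_rel A N M\<rbrakk>
      \<Longrightarrow> (x + x', y + y') \<in> tensor_rel A N M"

definition tensor ::
    "('a, 'r) ring_scheme \<Rightarrow> ('a, 'n, 's) module_scheme \<Rightarrow> ('a, 'm, 't) module_scheme
      \<Rightarrow> ('a, ('n \<times> 'm) multiset set) module" where
  "tensor A N M =
    \<lparr>carrier = {x. set_mset x \<subseteq> carrier N \<times> carrier M} // tensor_rel A N M,
     monoid.mult = undefined, one = undefined,
     zero = tensor_rel A N M `` {{#}},
     add = (\<lambda>X Y. \<Union>x\<in>X. \<Union>y\<in>Y. tensor_rel A N M `` {x + y}),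
     smult = (\<lambda>a X. \<Union>x\<in>X. tensor_rel A N M `` {image_mset (\<lambda>(n, m). (a \<odot>\<^bsub>N\<^esub> n, m)) x})\<rparr>"

text \<open>The action of the functor \<open>- \<otimes> M\<close> on an arrow \<open>f\<close> from \<open>N\<close> to \<open>N'\<close>.\<close>

definition tensor_map ::
    "('a, 'r) ring_scheme \<Rightarrow> ('a, 'm, 't) module_scheme
      \<Rightarrow> ('a, 'n, 's) module_scheme \<Rightarrow> ('a, 'k, 'u) module_scheme \<Rightarrow> ('n \<Rightarrow> 'k)
      \<Rightarrow> ('n \<times> 'm) multiset set \<Rightarrow> ('k \<times> 'm) multiset set" where
  "tensor_map A M N N' f =
    (\<lambda>X\<in>carrier (tensor A N M).
      \<Union>x\<in>X. tensor_rel A N' M `` {image_mset (\<lambda>(n, m). (f n, m)) x})"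


section \<open>Finite limits\<close>

record ('o, 'f) category =
  Ob :: "'o set"
  Ar :: "'f set"
  Src :: "'f \<Rightarrow> 'o"
  Tgt :: "'f \<Rightarrow> 'o"
  Ident :: "'o \<Rightarrow> 'f"
  Cmp :: "'f \<Rightarrow> 'f \<Rightarrow> 'f"

locale finite_category =
  fixes J :: "('o, 'f) category"
  assumes finite_Ob: "finite (Ob J)"
    and finite_Ar: "finite (Ar J)"
    and Src_closed: "f \<in> Ar J \<Longrightarrow> Src J f \<in> Ob J"
    and Tgt_closed: "f \<in> Ar J \<Longrightarrow> Tgt J f \<in> Ob J"
    and Ident_closed: "j \<in> Ob J \<Longrightarrow> Ident J j \<in> Ar J"
    and Src_Ident: "j \<in> Ob J \<Longrightarrow> Src J (Ident J j) = j"
    and Tgt_Ident: "j \<in> Ob J \<Longrightarrow> Tgt J (Ident J j) = j"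
    and Cmp_closed: "\<lbrakk>f \<in> Ar J; g \<in> Ar J; Tgt J f = Src J g\<rbrakk> \<Longrightarrow> Cmp J g f \<in> Ar J"
    and Src_Cmp: "\<lbrakk>f \<in> Ar J; g \<in> Ar J; Tgt J f = Src J g\<rbrakk> \<Longrightarrow> Src J (Cmp J g f) = Src J f"
    and Tgt_Cmp: "\<lbrakk>f \<in> Ar J; g \<in> Ar J; Tgt J f = Src J g\<rbrakk> \<Longrightarrow> Tgt J (Cmp J g f) = Tgt J g"
    and Cmp_Ident_right: "f \<in> Ar J \<Longrightarrow> Cmp J f (Ident J (Src J f)) = f"
    and Cmp_Ident_left: "f \<in> Ar J \<Longrightarrow> Cmp J (Ident J (Tgt J f)) f = f"
    and Cmp_assoc: "\<lbrakk>f \<in> Ar J; g \<in> Ar J; h \<in> Ar J; Tgt J f = Src J g; Tgt J g = Src J h\<rbrakk>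
      \<Longrightarrow> Cmp J h (Cmp J g f) = Cmp J (Cmp J h g) f"

text \<open>In the following, the \<open>A\<close>-modules whose carriers are subsets of a type \<open>'u\<close> are the objects
  of the category of \<open>A\<close>-modules relative to the universe \<open>'u\<close>. A diagram of shape \<open>J\<close> is a functor
  from \<open>J\<close> to this category, given by \<open>D\<close> on objects and \<open>F\<close> on arrows.\<close>

definition is_diagram ::
    "('a, 'r) ring_scheme \<Rightarrow> ('o, 'f) category \<Rightarrow> ('o \<Rightarrow> ('a, 'u) module) \<Rightarrow> ('f \<Rightarrow> 'u \<Rightarrow> 'u)
      \<Rightarrow> bool" where
  "is_diagram A J D F \<longleftrightarrow>
    (\<forall>j\<in>Ob J. semimodule A (D j)) \<and>
    (\<forall>f\<in>Ar J. F f \<in> semimodule_hom A (D (Src J f)) (D (Tgt J f))) \<and>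
    (\<forall>j\<in>Ob J. F (Ident J j) = (\<lambda>x\<in>carrier (D j). x)) \<and>
    (\<forall>f\<in>Ar J. \<forall>g\<in>Ar J. Tgt J f = Src J g \<longrightarrow>
      F (Cmp J g f) = compose (carrier (D (Src J f))) (F g) (F f))"

definition is_cone ::
    "('a, 'r) ring_scheme \<Rightarrow> ('o, 'f) category \<Rightarrow> ('o \<Rightarrow> ('a, 'u) module) \<Rightarrow> ('f \<Rightarrow> 'u \<Rightarrow> 'u)
      \<Rightarrow> ('a, 'u) module \<Rightarrow> ('o \<Rightarrow> 'u \<Rightarrow> 'u) \<Rightarrow> bool" where
  "is_cone A J D F L p \<longleftrightarrow>
    semimodule A L \<and>
    (\<forall>j\<in>Ob J. p j \<in> semimodule_hom A L (D j)) \<and>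
    (\<forall>f\<in>Ar J. compose (carrier L) (F f) (p (Src J f)) = p (Tgt J f))"

definition is_limit ::
    "('a, 'r) ring_scheme \<Rightarrow> ('o, 'f) category \<Rightarrow> ('o \<Rightarrow> ('a, 'u) module) \<Rightarrow> ('f \<Rightarrow> 'u \<Rightarrow> 'u)
      \<Rightarrow> ('a, 'u) module \<Rightarrow> ('o \<Rightarrow> 'u \<Rightarrow> 'u) \<Rightarrow> bool" where
  "is_limit A J D F L p \<longleftrightarrow>
    is_cone A J D F L p \<and>
    (\<forall>T t. is_cone A J D F T t \<longrightarrow>
      (\<exists>!h. h \<in> semimodule_hom A T L \<and> (\<forall>j\<in>Ob J. compose (carrier T) (p j) h = t j)))"


section \<open>Flatness\<close>

text \<open>HOL cannot quantify over all carrier types inside a definition, so the universe \<open>'u\<close> of the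
  modules to be tensored is a parameter. The tensor products live over the derived universe
  \<open>('u \<times> 'm) multiset set\<close>. When \<open>'u\<close> is infinite and at least as large as \<open>A\<close>, finite limits exist
  over \<open>'u\<close>, and limits over either universe are limits over every larger one, since both contain
  a copy of the free module of rank one. Shapes over \<open>nat\<close> cover all finite categories up to
  isomorphism.\<close>

definition flat_semimodule ::
    "'u itself \<Rightarrow> ('a, 'r) ring_scheme \<Rightarrow> ('a, 'm, 't) module_scheme \<Rightarrow> bool" where
  "flat_semimodule U A M \<longleftrightarrow>
    (\<forall>(J :: (nat, nat) category) (D :: nat \<Rightarrow> ('a, 'u) module) F L p.
      finite_category J \<longrightarrow> is_diagram A J D F \<longrightarrow> is_limit A J D F L p \<longrightarrow>
      is_limit A J
        (\<lambda>j. tensor A (D j) M)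
        (\<lambda>f. tensor_map A M (D (Src J f)) (D (Tgt J f)) (F f))
        (tensor A L M)
        (\<lambda>j. tensor_map A M L (D j) (p j)))"

definition flat_semiring_map ::
    "'u itself \<Rightarrow> ('a, 'r) ring_scheme \<Rightarrow> ('b, 's) ring_scheme \<Rightarrow> ('a \<Rightarrow> 'b) \<Rightarrow> bool" where
  "flat_semiring_map U A B f \<longleftrightarrow> flat_semimodule U A (restrict_scalars B f)"


section \<open>Well-formedness\<close>

lemma csemiring_on:
  assumes "0 \<in> S" "1 \<in> S" "\<And>x y. x \<in> S \<Longrightarrow> y \<in> S \<Longrightarrow> x + y \<in> S"
    "\<And>x y. x \<in> S \<Longrightarrow> y \<in> S \<Longrightarrow> x * y \<in> S"
  shows "csemiring (semiring_on S)"
  unfolding csemiring_def semiring_def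
  by (intro conjI abelian_monoidI comm_monoidI monoidI semiring_axioms.intro)
    (use assms in \<open>auto simp: semiring_on_def algebra_simps\<close>)

lemma csemiring_nat: "csemiring nat_semiring"
  and csemiring_nonneg_real: "csemiring nonneg_real_semiring"
  and csemiring_real: "csemiring real_semiring"
  unfolding nat_semiring_def nonneg_real_semiring_def real_semiring_def
  by (rule csemiring_on; simp)+

lemma csemiring_int: "csemiring \<Z>"
  using csemiring_on[of "UNIV :: int set"] by (simp add: semiring_on_def)

lemma int_semiring_hom: "int \<in> semiring_hom nat_semiring \<Z>"
  by (simp add: semiring_hom_def ring_hom_def nat_semiring_def semiring_on_def)

lemma real_semiring_hom: "(\<lambda>x. x) \<in> semiring_hom nonneg_real_semiring real_semiring"
  by (simp add: semiring_hom_def ring_hom_def nonneg_real_semiring_def real_semiring_def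
      semiring_on_def)

lemma semimodule_restrict_scalars:
  assumes "csemiring A" "csemiring B" "f \<in> semiring_hom A B"
  shows "semimodule A (restrict_scalars B f)"
proof -
  interpret A: csemiring A by fact
  interpret B: csemiring B by fact
  have f: "f a \<in> carrier B" if "a \<in> carrier A" for a
    using assms(3) that by (auto simp: semiring_hom_def ring_hom_def)
  show ?thesis
    unfolding semimodule_def
    by (intro conjI assms(1) abelian_monoidI semimodule_axioms.intro)
      (use assms(3) in \<open>auto simp: restrict_scalars_def semiring_hom_def ring_hom_def f B.a_assoc
        B.a_comm B.add.m_lcomm B.l_distr B.r_distr B.m_assoc\<close>)
qed

lemma equiv_tensor_rel:
  assumes "semimodule A N" "semimodule A M"
  shows "equiv {x. set_mset x \<subseteq> carrier N \<times> carrier M} (tensor_rel A N M)"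
proof -
  interpret N: semimodule A N by fact
  interpret M: semimodule A M by fact
  have sub: "set_mset x \<subseteq> carrier N \<times> carrier M \<and> set_mset y \<subseteq> carrier N \<times> carrier M"
    if "(x, y) \<in> tensor_rel A N M" for x y
    using that by induction (auto simp: N.smult_closed M.smult_closed)
  show ?thesis
    by (rule equivI) (auto intro!: refl_onI symI transI dest: sub intro: tensor_rel.intros)
qed

lemma tensor_rel_image:
  assumes "semimodule A N" "semimodule A N'" "semimodule A M"
    and f: "\<And>n. n \<in> carrier N \<Longrightarrow> f n \<in> carrier N'"
    and f0: "f \<zero>\<^bsub>N\<^esub> = \<zero>\<^bsub>N'\<^esub>"
    and fadd: "\<And>x y. \<lbrakk>x \<in> carrier N; y \<in> carrier N\<rbrakk> \<Longrightarrow> f (x \<oplus>\<^bsub>N\<^esub> y) = f x \<oplus>\<^bsub>N'\<^esub> f y"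
    and fsmult: "\<And>a x. \<lbrakk>a \<in> carrier A; x \<in> carrier N\<rbrakk> \<Longrightarrow> f (a \<odot>\<^bsub>N\<^esub> x) = a \<odot>\<^bsub>N'\<^esub> f x"
    and r: "(x, y) \<in> tensor_rel A N M"
  shows "(image_mset (\<lambda>(n, m). (f n, m)) x, image_mset (\<lambda>(n, m). (f n, m)) y)
    \<in> tensor_rel A N' M"
  using r
proof induction
  case (refl x)
  then show ?case using f by (force intro!: tensor_rel.refl)
qed (auto simp: f f0 fadd fsmult intro: tensor_rel.intros)

lemma tensor_add:
  assumes N: "semimodule A N" and M: "semimodule A M"
    and x: "x \<in> {x. set_mset x \<subseteq> carrier N \<times> carrier M}"
    and y: "y \<in> {x. set_mset x \<subseteq> carrier N \<times> carrier M}"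
  shows "add (tensor A N M) (tensor_rel A N M `` {x}) (tensor_rel A N M `` {y})
    = tensor_rel A N M `` {x + y}"
proof -
  let ?r = "tensor_rel A N M"
  note eq = equiv_tensor_rel[OF N M]
  have "congruent2 ?r ?r (\<lambda>x y. ?r `` {x + y})"
    by (rule congruent2I') (metis equiv_class_eq[OF eq] tensor_rel.plus)
  from UN_equiv_class2[OF eq eq this x y] show ?thesis
    by (simp add: tensor_def)
qed

lemma tensor_smult:
  assumes N: "semimodule A N" and M: "semimodule A M" and a: "a \<in> carrier A"
    and x: "x \<in> {x. set_mset x \<subseteq> carrier N \<times> carrier M}"
  shows "smult (tensor A N M) a (tensor_rel A N M `` {x})
    = tensor_rel A N M `` {image_mset (\<lambda>(n, m). (a \<odot>\<^bsub>N\<^esub> n, m)) x}"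
proof -
  interpret N: semimodule A N by fact
  interpret M: semimodule A M by fact
  let ?r = "tensor_rel A N M"
  let ?im = "\<lambda>a. image_mset (\<lambda>(n, m). (a \<odot>\<^bsub>N\<^esub> n, m))"
  note eq = equiv_tensor_rel[OF N M]
  have im_rel: "(?im a x, ?im a y) \<in> ?r" if "(x, y) \<in> ?r" for x y
    using that a by (intro tensor_rel_image[OF N N M])
      (auto simp: N.smult_closed N.smult_r_distr N.smult_r_null N.smult_assoc[symmetric]
        N.m_comm)
  have "(\<lambda>x. ?r `` {?im a x}) respects ?r"
    by (rule congruentI) (metis equiv_class_eq[OF eq] im_rel)
  from UN_equiv_class[OF eq this x] show ?thesis
    by (simp add: tensor_def)
qed

lemma semimodule_tensor:
  assumes N: "semimodule A N" and M: "semimodule A M"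
  shows "semimodule A (tensor A N M)"
proof -
  interpret N: semimodule A N by fact
  interpret M: semimodule A M by fact
  let ?S = "{x. set_mset x \<subseteq> carrier N \<times> carrier M}"
  let ?r = "tensor_rel A N M"
  let ?T = "tensor A N M"
  let ?im = "\<lambda>a. image_mset (\<lambda>(n, m). (a \<odot>\<^bsub>N\<^esub> n, m))"
  note eq = equiv_tensor_rel[OF N M]
  note add = tensor_add[OF N M] and smult = tensor_smult[OF N M]
  have im: "?im a x \<in> ?S" if "a \<in> carrier A" "x \<in> ?S" for a x
    using that by (auto simp: N.smult_closed)
  have im_add: "(?im (a \<oplus>\<^bsub>A\<^esub> b) x, ?im a x + ?im b x) \<in> ?r"
    if ab: "a \<in> carrier A" "b \<in> carrier A" and "x \<in> ?S" for a b x
    using \<open>x \<in> ?S\<close>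
  proof (induction x)
    case empty
    then show ?case by (simp add: tensor_rel.refl)
  next
    case (add p x)
    obtain n m where p: "p = (n, m)" "n \<in> carrier N" "m \<in> carrier M" using add by auto
    have "({#(a \<odot>\<^bsub>N\<^esub> n \<oplus>\<^bsub>N\<^esub> b \<odot>\<^bsub>N\<^esub> n, m)#}, {#(a \<odot>\<^bsub>N\<^esub> n, m), (b \<odot>\<^bsub>N\<^esub> n, m)#}) \<in> ?r"
      using p ab by (intro tensor_rel.add_left) (auto simp: N.smult_closed)
    from tensor_rel.plus[OF this add.IH] add.prems p ab show ?case
      by (simp add: N.smult_l_distr add_mset_commute)
  qed
  have im_zero: "(?im \<zero>\<^bsub>A\<^esub> x, {#}) \<in> ?r" if "x \<in> ?S" for x
    using that
  proof (induction x)
    case empty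
    then show ?case by (simp add: tensor_rel.refl)
  next
    case (add p x)
    obtain n m where p: "p = (n, m)" "n \<in> carrier N" "m \<in> carrier M" using add by auto
    have "({#(\<zero>\<^bsub>N\<^esub>, m)#}, {#}) \<in> ?r"
      using p by (intro tensor_rel.zero_left) auto
    from tensor_rel.plus[OF this add.IH] add.prems p show ?case
      by (simp add: N.smult_l_null)
  qed
  have im_mult: "?im (a \<otimes>\<^bsub>A\<^esub> b) x = ?im a (?im b x)"
    if "a \<in> carrier A" "b \<in> carrier A" "x \<in> ?S" for a b x
    using that by (auto simp: multiset.map_comp N.smult_assoc intro!: image_mset_cong)
  have im_one: "?im \<one>\<^bsub>A\<^esub> x = x" if "x \<in> ?S" for x
  proof -
    have "?im \<one>\<^bsub>A\<^esub> x = image_mset (\<lambda>p. p) x"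
      using that by (intro image_mset_cong) (auto simp: N.smult_one)
    then show ?thesis by simp
  qed
  have carr: "X \<in> carrier ?T \<longleftrightarrow> (\<exists>x\<in>?S. X = ?r `` {x})" for X
    by (auto simp: tensor_def quotient_def)
  have cl: "?r `` {x} \<in> carrier ?T" if "x \<in> ?S" for x
    using that carr by blast
  have zero: "zero ?T = ?r `` {{#}}"
    by (simp add: tensor_def)
  have plusS: "x + y \<in> ?S" if "x \<in> ?S" "y \<in> ?S" for x y
    using that by auto
  have emptyS: "{#} \<in> ?S" by simp
  have cls: "?r `` {x} = ?r `` {y}" if "(x, y) \<in> ?r" for x y
    using equiv_class_eq[OF eq that] .
  have ac: "Group.comm_monoid (add_monoid ?T)"
    using abelian_monoidI[of ?T] add plusS emptyS zero carr cl
    by (smt (verit, ccfv_threshold) abelian_monoid.a_comm_monoid add.assoc add.commute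
        add.left_neutral)
  show ?thesis
    unfolding semimodule_def
  proof (intro conjI semimodule_axioms.intro)
    show "csemiring A" by (rule N.csemiring_axioms)
    show "abelian_monoid ?T" using ac by (rule abelian_monoid.intro)
  next
    fix a X assume a: "a \<in> carrier A" and "X \<in> carrier ?T"
    then obtain x where x: "x \<in> ?S" "X = ?r `` {x}" using carr by blast
    show "a \<odot>\<^bsub>?T\<^esub> X \<in> carrier ?T"
      using smult[OF a x(1)] cl[OF im[OF a x(1)]] x(2) by simp
  next
    fix a b X assume a: "a \<in> carrier A" and b: "b \<in> carrier A" and "X \<in> carrier ?T"
    then obtain x where x: "x \<in> ?S" "X = ?r `` {x}" using carr by blast
    show "(a \<oplus>\<^bsub>A\<^esub> b) \<odot>\<^bsub>?T\<^esub> X = a \<odot>\<^bsub>?T\<^esub> X \<oplus>\<^bsub>?T\<^esub> b \<odot>\<^bsub>?T\<^esub> X"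
      unfolding x(2) smult[OF a x(1)] smult[OF b x(1)] smult[OF N.R.add.m_closed[OF a b] x(1)]
        add[OF im[OF a x(1)] im[OF b x(1)]]
      by (rule cls[OF im_add[OF a b x(1)]])
    show "(a \<otimes>\<^bsub>A\<^esub> b) \<odot>\<^bsub>?T\<^esub> X = a \<odot>\<^bsub>?T\<^esub> (b \<odot>\<^bsub>?T\<^esub> X)"
      unfolding x(2) smult[OF b x(1)] smult[OF a im[OF b x(1)]] smult[OF N.R.m_closed[OF a b] x(1)]
        im_mult[OF a b x(1)] ..
  next
    fix a X Y assume a: "a \<in> carrier A" and "X \<in> carrier ?T" "Y \<in> carrier ?T"
    then obtain x y where x: "x \<in> ?S" "X = ?r `` {x}" and y: "y \<in> ?S" "Y = ?r `` {y}"
      using carr by metis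
    show "a \<odot>\<^bsub>?T\<^esub> (X \<oplus>\<^bsub>?T\<^esub> Y) = a \<odot>\<^bsub>?T\<^esub> X \<oplus>\<^bsub>?T\<^esub> a \<odot>\<^bsub>?T\<^esub> Y"
      unfolding x(2) y(2) smult[OF a x(1)] smult[OF a y(1)] add[OF x(1) y(1)]
        smult[OF a plusS[OF x(1) y(1)]] add[OF im[OF a x(1)] im[OF a y(1)]]
      by simp
  next
    fix X assume "X \<in> carrier ?T"
    then obtain x where x: "x \<in> ?S" "X = ?r `` {x}" using carr by blast
    show "\<one>\<^bsub>A\<^esub> \<odot>\<^bsub>?T\<^esub> X = X"
      unfolding x(2) smult[OF N.R.one_closed x(1)] im_one[OF x(1)] ..
    show "\<zero>\<^bsub>A\<^esub> \<odot>\<^bsub>?T\<^esub> X = \<zero>\<^bsub>?T\<^esub>"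
      unfolding x(2) zero smult[OF N.R.zero_closed x(1)]
      by (rule cls[OF im_zero[OF x(1)]])
  next
    fix a assume a: "a \<in> carrier A"
    show "a \<odot>\<^bsub>?T\<^esub> \<zero>\<^bsub>?T\<^esub> = \<zero>\<^bsub>?T\<^esub>"
      unfolding zero smult[OF a emptyS] by simp
  qed
qed

lemma tensor_map_hom:
  assumes N: "semimodule A N" and N': "semimodule A N'" and M: "semimodule A M"
    and f: "f \<in> semimodule_hom A N N'"
  shows "tensor_map A M N N' f \<in> semimodule_hom A (tensor A N M) (tensor A N' M)"
proof -
  interpret N: semimodule A N by fact
  interpret M: semimodule A M by fact
  let ?S = "{x. set_mset x \<subseteq> carrier N \<times> carrier M}"
  let ?S' = "{x. set_mset x \<subseteq> carrier N' \<times> carrier M}"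
  let ?T = "tensor A N M" and ?T' = "tensor A N' M"
  let ?r = "tensor_rel A N M" and ?r' = "tensor_rel A N' M"
  let ?f = "image_mset (\<lambda>(n, m). (f n, m))"
  let ?im = "\<lambda>a. image_mset (\<lambda>(n, m). (a \<odot>\<^bsub>N\<^esub> n, m))"
  let ?im' = "\<lambda>a. image_mset (\<lambda>(n, m). (a \<odot>\<^bsub>N'\<^esub> n, m))"
  have fcl: "f n \<in> carrier N'" if "n \<in> carrier N" for n
    using f that by (auto simp: semimodule_hom_def)
  have fsm: "f (a \<odot>\<^bsub>N\<^esub> n) = a \<odot>\<^bsub>N'\<^esub> f n" if "a \<in> carrier A" "n \<in> carrier N" for a n
    using f that by (simp add: semimodule_hom_def)
  have rel: "(?f x, ?f y) \<in> ?r'" if "(x, y) \<in> ?r" for x y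
    by (rule tensor_rel_image[OF N N' M _ _ _ _ that]) (use f in \<open>auto simp: semimodule_hom_def\<close>)
  have fS: "?f x \<in> ?S'" if "x \<in> ?S" for x
    using that fcl by force
  have carr: "\<exists>x\<in>?S. X = ?r `` {x}" if "X \<in> carrier ?T" for X
    using that by (auto simp: tensor_def quotient_def)
  have cl: "?r `` {x} \<in> carrier ?T" if "x \<in> ?S" for x
    using that by (auto simp: tensor_def quotient_def)
  have cl': "?r' `` {x} \<in> carrier ?T'" if "x \<in> ?S'" for x
    using that by (auto simp: tensor_def quotient_def)
  have val: "tensor_map A M N N' f (?r `` {x}) = ?r' `` {?f x}" if "x \<in> ?S" for x
  proof -
    have "(\<lambda>x. ?r' `` {?f x}) respects ?r"
      by (rule congruentI) (metis equiv_class_eq[OF equiv_tensor_rel[OF N' M]] rel)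
    from UN_equiv_class[OF equiv_tensor_rel[OF N M] this that] cl[OF that] show ?thesis
      by (simp add: tensor_map_def)
  qed
  have ff: "?f (?im a x) = ?im' a (?f x)" if "a \<in> carrier A" "x \<in> ?S" for a x
    using that by (auto simp: multiset.map_comp fsm intro!: image_mset_cong)
  have im: "?im a x \<in> ?S" if "a \<in> carrier A" "x \<in> ?S" for a x
    using that by (auto simp: N.smult_closed)
  have plusS: "x + y \<in> ?S" if "x \<in> ?S" "y \<in> ?S" for x y
    using that by auto
  show ?thesis
    unfolding semimodule_hom_def
  proof (intro CollectI conjI ballI PiE_I)
    fix X assume "X \<in> carrier ?T"
    then obtain x where x: "x \<in> ?S" "X = ?r `` {x}" using carr by blast
    show "tensor_map A M N N' f X \<in> carrier ?T'"
      unfolding x(2) val[OF x(1)] by (rule cl'[OF fS[OF x(1)]])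
  next
    fix X assume "X \<notin> carrier ?T"
    then show "tensor_map A M N N' f X = undefined" by (simp add: tensor_map_def)
  next
    have "tensor_map A M N N' f (?r `` {{#}}) = ?r' `` {{#}}"
      by (subst val) auto
    then show "tensor_map A M N N' f \<zero>\<^bsub>?T\<^esub> = \<zero>\<^bsub>?T'\<^esub>"
      by (simp add: tensor_def)
  next
    fix X Y assume "X \<in> carrier ?T" "Y \<in> carrier ?T"
    then obtain x y where x: "x \<in> ?S" "X = ?r `` {x}" and y: "y \<in> ?S" "Y = ?r `` {y}"
      using carr by metis
    show "tensor_map A M N N' f (X \<oplus>\<^bsub>?T\<^esub> Y)
        = tensor_map A M N N' f X \<oplus>\<^bsub>?T'\<^esub> tensor_map A M N N' f Y"
      unfolding x(2) y(2) tensor_add[OF N M x(1) y(1)] val[OF x(1)] val[OF y(1)]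
        val[OF plusS[OF x(1) y(1)]] tensor_add[OF N' M fS[OF x(1)] fS[OF y(1)]]
      by simp
  next
    fix a X assume a: "a \<in> carrier A" and "X \<in> carrier ?T"
    then obtain x where x: "x \<in> ?S" "X = ?r `` {x}" using carr by blast
    show "tensor_map A M N N' f (a \<odot>\<^bsub>?T\<^esub> X) = a \<odot>\<^bsub>?T'\<^esub> tensor_map A M N N' f X"
      unfolding x(2) tensor_smult[OF N M a x(1)] val[OF x(1)] val[OF im[OF a x(1)]]
        tensor_smult[OF N' M a fS[OF x(1)]] ff[OF a x(1)] ..
  qed
qed

end

theory Submission
  imports Defs
begin

text \<open>Let \<open>A\<close> be a non-trivial semiring in which a sum vanishes only if both summands do and a
  product only if one factor does, as in \<open>\<nat>\<close> and \<open>\<real>\<^sub>+\<close>. Then the map from \<open>A\<close> to the module of truth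
  values that tells whether a scalar is non-zero is linear (\<open>support_hom\<close>), and its kernel, the
  equalizer of this map and the zero map, is trivial.

  Let \<open>A \<rightarrow> B\<close> be a semiring map to a non-trivial ring. Disjunction is idempotent and \<open>B\<close> has
  additive inverses, so the truth values tensored with \<open>B\<close> form a group of idempotents, which is
  zero (\<open>tensor_rel_idempotent_invertible\<close>). After tensoring, both parallel maps are therefore
  zero and their equalizer is all of \<open>A \<otimes> B\<close>. If \<open>B\<close> were flat, this would be the zero module
  (\<open>flat_semimodule_trivial_kernel\<close>); but multiplication maps \<open>1 \<otimes> 1\<close> to \<open>1 \<noteq> 0\<close> in \<open>B\<close>.

  The modules of the equalizer diagram have to lie in the given universe. It contains a copy of
  the carrier of \<open>A\<close>, inside which all of them are built.\<close>

section \<open>Computing in tensor products\<close>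

lemma tensor_carrier_cases:
  assumes "X \<in> carrier (tensor A N M)"
  obtains x where "set_mset x \<subseteq> carrier N \<times> carrier M" "X = tensor_rel A N M `` {x}"
  using assms by (auto simp: tensor_def quotient_def)

lemma tensor_class_closed:
  assumes "set_mset x \<subseteq> carrier N \<times> carrier M"
  shows "tensor_rel A N M `` {x} \<in> carrier (tensor A N M)"
  using assms by (auto simp: tensor_def quotient_def)

lemma tensor_zero: "\<zero>\<^bsub>tensor A N M\<^esub> = tensor_rel A N M `` {{#}}"
  by (simp add: tensor_def)

lemma tensor_map_class:
  assumes N: "semimodule A N" and N': "semimodule A N'" and M: "semimodule A M"
    and f: "f \<in> semimodule_hom A N N'" and x: "set_mset x \<subseteq> carrier N \<times> carrier M"
  shows "tensor_map A M N N' f (tensor_rel A N M `` {x})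
    = tensor_rel A N' M `` {image_mset (\<lambda>(n, m). (f n, m)) x}"
proof -
  let ?r = "tensor_rel A N M" and ?r' = "tensor_rel A N' M"
  let ?f = "image_mset (\<lambda>(n, m). (f n, m))"
  have rel: "(?f x, ?f y) \<in> ?r'" if "(x, y) \<in> ?r" for x y
    by (rule tensor_rel_image[OF N N' M _ _ _ _ that]) (use f in \<open>auto simp: semimodule_hom_def\<close>)
  have "(\<lambda>x. ?r' `` {?f x}) respects ?r"
    by (rule congruentI) (metis equiv_class_eq[OF equiv_tensor_rel[OF N' M]] rel)
  from UN_equiv_class[OF equiv_tensor_rel[OF N M] this, of x] x tensor_class_closed[OF x, of A]
  show ?thesis
    by (simp add: tensor_map_def)
qed

lemma tensor_map_id:
  assumes N: "semimodule A N" and M: "semimodule A M"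
    and id: "(\<lambda>n\<in>carrier N. n) \<in> semimodule_hom A N N"
    and X: "X \<in> carrier (tensor A N M)"
  shows "tensor_map A M N N (\<lambda>n\<in>carrier N. n) X = X"
proof -
  obtain x where x: "set_mset x \<subseteq> carrier N \<times> carrier M" "X = tensor_rel A N M `` {x}"
    using X by (rule tensor_carrier_cases)
  have "image_mset (\<lambda>(n, m). ((\<lambda>n\<in>carrier N. n) n, m)) x = image_mset (\<lambda>p. p) x"
    by (rule image_mset_cong) (use x(1) in auto)
  then show ?thesis
    unfolding x(2) tensor_map_class[OF N N M id x(1)] by simp
qed

lemma tensor_rel_empty:
  assumes "\<And>p. p \<in># x \<Longrightarrow> ({#p#}, {#}) \<in> tensor_rel A N M"
  shows "(x, {#}) \<in> tensor_rel A N M"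
  using assms
proof (induction x)
  case empty
  show ?case by (simp add: tensor_rel.refl)
next
  case (add p x)
  have "({#p#} + x, {#} + {#}) \<in> tensor_rel A N M"
    by (rule tensor_rel.plus) (use add in auto)
  then show ?case by simp
qed

lemma tensor_class_eq_zero:
  assumes "semimodule A N" "semimodule A M" "(x, {#}) \<in> tensor_rel A N M"
  shows "tensor_rel A N M `` {x} = \<zero>\<^bsub>tensor A N M\<^esub>"
  unfolding tensor_zero by (rule equiv_class_eq[OF equiv_tensor_rel[OF assms(1,2)] assms(3)])

lemma tensor_trivial:
  assumes N: "semimodule A N" and M: "semimodule A M"
    and pure: "\<And>n m. \<lbrakk>n \<in> carrier N; m \<in> carrier M\<rbrakk> \<Longrightarrow> ({#(n, m)#}, {#}) \<in> tensor_rel A N M"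
    and X: "X \<in> carrier (tensor A N M)"
  shows "X = \<zero>\<^bsub>tensor A N M\<^esub>"
proof -
  obtain x where x: "set_mset x \<subseteq> carrier N \<times> carrier M" "X = tensor_rel A N M `` {x}"
    using X by (rule tensor_carrier_cases)
  show ?thesis
    unfolding x(2) by (rule tensor_class_eq_zero[OF N M tensor_rel_empty]) (use x(1) pure in auto)
qed

text \<open>If \<open>m + m' = 0\<close> and \<open>n + n = n\<close>, then \<open>n \<otimes> m = n \<otimes> m + n \<otimes> m + n \<otimes> m' =
  (n + n) \<otimes> m + n \<otimes> m' = n \<otimes> m + n \<otimes> m' = 0\<close>: an idempotent that has an inverse is zero.\<close>

lemma tensor_rel_idempotent_invertible:
  assumes N: "semimodule A N" and M: "semimodule A M"
    and n: "n \<in> carrier N" "n \<oplus>\<^bsub>N\<^esub> n = n"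
    and m: "m \<in> carrier M" "m' \<in> carrier M" "m \<oplus>\<^bsub>M\<^esub> m' = \<zero>\<^bsub>M\<^esub>"
  shows "({#(n, m)#}, {#}) \<in> tensor_rel A N M"
proof -
  let ?r = "tensor_rel A N M"
  have refl: "({#(n, k)#}, {#(n, k)#}) \<in> ?r" if "k \<in> carrier M" for k
    using that n by (intro tensor_rel.refl) auto
  have cancel: "({#(n, m), (n, m')#}, {#}) \<in> ?r"
    using tensor_rel.add_right[of n N m M m' A] tensor_rel.zero_right[of n N M A] n(1) m
    by (metis tensor_rel.sym tensor_rel.trans)
  have double: "({#(n, m)#}, {#(n, m), (n, m)#}) \<in> ?r"
    using tensor_rel.add_left[of n N n m M A] n m(1) by simp
  have "({#(n, m)#} + {#}, {#(n, m)#} + {#(n, m), (n, m')#}) \<in> ?r"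
    by (rule tensor_rel.plus[OF refl[OF m(1)] tensor_rel.sym[OF cancel]])
  moreover have "({#(n, m)#} + {#(n, m), (n, m')#}, {#(n, m), (n, m')#}) \<in> ?r"
    using tensor_rel.plus[OF tensor_rel.sym[OF double] refl[OF m(2)]]
    by (simp add: add_mset_commute)
  ultimately have "({#(n, m)#}, {#(n, m), (n, m')#}) \<in> ?r"
    by (metis add.right_neutral tensor_rel.trans)
  then show ?thesis using cancel by (rule tensor_rel.trans)
qed

text \<open>The easy half of the universal property of the tensor product, for bilinear maps into a
  commutative monoid; it is the tool for telling tensors apart.\<close>

lemma tensor_rel_bilinear_invariant:
  fixes b :: "'n \<Rightarrow> 'm \<Rightarrow> 'c::comm_monoid_add"
  assumes "(x, y) \<in> tensor_rel A N M"
    and "\<And>n n' m. \<lbrakk>n \<in> carrier N; n' \<in> carrier N; m \<in> carrier M\<rbrakk>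
      \<Longrightarrow> b (n \<oplus>\<^bsub>N\<^esub> n') m = b n m + b n' m"
    and "\<And>n m m'. \<lbrakk>n \<in> carrier N; m \<in> carrier M; m' \<in> carrier M\<rbrakk>
      \<Longrightarrow> b n (m \<oplus>\<^bsub>M\<^esub> m') = b n m + b n m'"
    and "\<And>m. m \<in> carrier M \<Longrightarrow> b \<zero>\<^bsub>N\<^esub> m = 0"
    and "\<And>n. n \<in> carrier N \<Longrightarrow> b n \<zero>\<^bsub>M\<^esub> = 0"
    and "\<And>a n m. \<lbrakk>a \<in> carrier A; n \<in> carrier N; m \<in> carrier M\<rbrakk>
      \<Longrightarrow> b (a \<odot>\<^bsub>N\<^esub> n) m = b n (a \<odot>\<^bsub>M\<^esub> m)"
  shows "(\<Sum>(n, m)\<in>#x. b n m) = (\<Sum>(n, m)\<in>#y. b n m)"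
  using assms(1)
proof induction
  case (balanced a n m)
  show ?case by (simp, rule assms(6)[OF balanced])
qed (simp_all add: assms(2-5))


section \<open>Flat modules preserve trivial kernels\<close>

text \<open>The shape of an equalizer: the arrows \<open>0\<close> and \<open>1\<close> are the identities of the two objects,
  and \<open>2\<close> and \<open>3\<close> are the parallel arrows from \<open>0\<close> to \<open>1\<close>. In a composable pair, the first arrow is the
  identity of \<open>0\<close> or the second one is the identity of \<open>1\<close>.\<close>

definition parallel_pair :: "(nat, nat) category" where
  "parallel_pair = \<lparr>Ob = {0, 1}, Ar = {0, 1, 2, 3},
    Src = (\<lambda>f. if f = 1 then 1 else 0), Tgt = (\<lambda>f. if f = 0 then 0 else 1),
    Ident = (\<lambda>j. j), Cmp = (\<lambda>g f. if f = 0 then g else f)\<rparr>"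

lemma finite_category_parallel_pair: "finite_category parallel_pair"
proof -
  have simps: "Ob parallel_pair = {0, 1}" "Ar parallel_pair = {0, 1, 2, 3}"
    "Ident parallel_pair j = j" "Src parallel_pair f = 1 \<longleftrightarrow> f = 1"
    "Src parallel_pair f = 0 \<longleftrightarrow> f \<noteq> 1" "Tgt parallel_pair f = 0 \<longleftrightarrow> f = 0"
    "Tgt parallel_pair f = 1 \<longleftrightarrow> f \<noteq> 0" "Cmp parallel_pair g f = (if f = 0 then g else f)"
    for f g j
    by (simp_all add: parallel_pair_def)
  show ?thesis
    by unfold_locales (simp_all only: simps, auto simp: parallel_pair_def)
qed

lemma identity_hom:
  assumes "semimodule A N"
  shows "(\<lambda>n\<in>carrier N. n) \<in> semimodule_hom A N N"
proof -
  interpret semimodule A N by fact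
  show ?thesis by (auto simp: semimodule_hom_def smult_closed)
qed

lemma zero_hom:
  assumes "semimodule A N" "semimodule A N'"
  shows "(\<lambda>n\<in>carrier N. \<zero>\<^bsub>N'\<^esub>) \<in> semimodule_hom A N N'"
proof -
  interpret N: semimodule A N by fact
  interpret N': semimodule A N' by fact
  show ?thesis by (auto simp: semimodule_hom_def N.smult_closed N'.smult_r_null)
qed

lemma semimodule_zero_submodule:
  assumes "semimodule A N"
  shows "semimodule A (N\<lparr>carrier := {\<zero>\<^bsub>N\<^esub>}\<rparr>)"
proof -
  interpret semimodule A N by fact
  show ?thesis
    unfolding semimodule_def
    by (intro conjI R.csemiring_axioms abelian_monoidI semimodule_axioms.intro)
      (auto simp: smult_r_null)
qed

text \<open>Without subtraction, \<open>h\<close> may have trivial kernel without being injective. Its kernel is the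
  equalizer of \<open>h\<close> and the zero map, and a flat module preserves this equalizer. Hence the kernel
  of \<open>h \<otimes> M\<close> is \<open>0 \<otimes> M = 0\<close>; here this is used when \<open>h \<otimes> M\<close> is zero, so that the whole of
  \<open>N \<otimes> M\<close> is a cone over the tensored diagram.\<close>

lemma flat_semimodule_trivial_kernel:
  fixes N N' :: "('a, 'u) module"
  assumes flat: "flat_semimodule TYPE('u) A M" and M: "semimodule A M"
    and N: "semimodule A N" and N': "semimodule A N'"
    and h: "h \<in> semimodule_hom A N N'"
    and ker: "\<And>n. \<lbrakk>n \<in> carrier N; h n = \<zero>\<^bsub>N'\<^esub>\<rbrakk> \<Longrightarrow> n = \<zero>\<^bsub>N\<^esub>"
    and kills: "\<And>X. X \<in> carrier (tensor A N M)
      \<Longrightarrow> tensor_map A M N N' h X = \<zero>\<^bsub>tensor A N' M\<^esub>"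
    and X: "X \<in> carrier (tensor A N M)"
  shows "X = \<zero>\<^bsub>tensor A N M\<^esub>"
proof -
  interpret N: semimodule A N by fact
  interpret N': semimodule A N' by fact
  define D where "D j = (if j = 0 then N else N')" for j :: nat
  define F where "F k = (if k = 0 then (\<lambda>n\<in>carrier N. n) else if k = 1 then (\<lambda>n\<in>carrier N'. n)
    else if k = 2 then h else (\<lambda>n\<in>carrier N. \<zero>\<^bsub>N'\<^esub>))" for k :: nat
  define L where "L = N\<lparr>carrier := {\<zero>\<^bsub>N\<^esub>}\<rparr>"
  define p where "p j = (\<lambda>n\<in>carrier L. \<zero>\<^bsub>D j\<^esub>)" for j :: nat
  have L: "semimodule A L"
    unfolding L_def by (rule semimodule_zero_submodule[OF N])
  have D: "semimodule A (D j)" for j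
    by (simp add: D_def N N')
  have hcl: "h n \<in> carrier N'" if "n \<in> carrier N" for n
    using h that by (auto simp: semimodule_hom_def)
  have h0: "h \<zero>\<^bsub>N\<^esub> = \<zero>\<^bsub>N'\<^esub>" and hext: "h \<in> extensional (carrier N)"
    using h by (auto simp: semimodule_hom_def PiE_def)
  have diagram: "is_diagram A parallel_pair D F"
    unfolding is_diagram_def
  proof (intro conjI)
    show "\<forall>f\<in>Ar parallel_pair.
        F f \<in> semimodule_hom A (D (Src parallel_pair f)) (D (Tgt parallel_pair f))"
      using h identity_hom[OF N] identity_hom[OF N'] zero_hom[OF N N']
      by (simp add: parallel_pair_def D_def F_def)
    show "\<forall>f\<in>Ar parallel_pair. \<forall>g\<in>Ar parallel_pair.
        Tgt parallel_pair f = Src parallel_pair g \<longrightarrow>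
        F (Cmp parallel_pair g f) = compose (carrier (D (Src parallel_pair f))) (F g) (F f)"
      using hext hcl
      by (auto simp: parallel_pair_def D_def F_def compose_def extensional_def fun_eq_iff)
  qed (auto simp: N N' parallel_pair_def D_def F_def)
  have p: "p j \<in> semimodule_hom A L (D j)" for j
    unfolding p_def by (rule zero_hom[OF L D])
  have limit: "is_limit A parallel_pair D F L p"
    unfolding is_limit_def
  proof (intro conjI allI impI)
    show "is_cone A parallel_pair D F L p"
      unfolding is_cone_def using L p h0
      by (auto simp: parallel_pair_def F_def D_def p_def compose_def L_def fun_eq_iff)
  next
    fix T t assume cone: "is_cone A parallel_pair D F T t"
    then have T: "semimodule A T" and t: "t j \<in> semimodule_hom A T (D j)" if "j \<in> {0, 1}" for j
      using that by (auto simp: is_cone_def parallel_pair_def)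
    have t0: "t 0 \<in> carrier T \<rightarrow>\<^sub>E carrier N" and t1: "t 1 \<in> carrier T \<rightarrow>\<^sub>E carrier N'"
      using t[of 0] t[of 1] by (auto simp: semimodule_hom_def D_def)
    have "compose (carrier T) h (t 0) = t 1"
      and "compose (carrier T) (\<lambda>n\<in>carrier N. \<zero>\<^bsub>N'\<^esub>) (t 0) = t 1"
      using cone by (auto simp: is_cone_def parallel_pair_def F_def)
    then have "h (t 0 y) = t 1 y" and t1_zero: "t 1 y = \<zero>\<^bsub>N'\<^esub>" if "y \<in> carrier T" for y
      using PiE_mem[OF t0 that] compose_eq[OF that] by (metis, metis restrict_apply')
    then have t0_zero: "t 0 y = \<zero>\<^bsub>N\<^esub>" if "y \<in> carrier T" for y
      using that t0 ker by (auto simp: PiE_mem)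
    show "\<exists>!u. u \<in> semimodule_hom A T L \<and>
        (\<forall>j\<in>Ob parallel_pair. compose (carrier T) (p j) u = t j)"
    proof (intro ex1I[of _ "\<lambda>y\<in>carrier T. \<zero>\<^bsub>L\<^esub>"] conjI)
      show "(\<lambda>y\<in>carrier T. \<zero>\<^bsub>L\<^esub>) \<in> semimodule_hom A T L"
        using T[of 0] by (simp add: zero_hom L)
      have "compose (carrier T) (p j) (\<lambda>y\<in>carrier T. \<zero>\<^bsub>L\<^esub>) = t j" if "j \<in> {0, 1}" for j
      proof (rule extensionalityI[of _ "carrier T"])
        show "t j \<in> extensional (carrier T)"
          using t0 t1 that by (auto simp: PiE_def)
      qed (use that t0_zero t1_zero in \<open>auto simp: compose_def p_def L_def D_def\<close>)
      then show "\<forall>j\<in>Ob parallel_pair. compose (carrier T) (p j) (\<lambda>y\<in>carrier T. \<zero>\<^bsub>L\<^esub>) = t j"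
        by (simp add: parallel_pair_def)
    next
      fix u assume "u \<in> semimodule_hom A T L \<and>
        (\<forall>j\<in>Ob parallel_pair. compose (carrier T) (p j) u = t j)"
      then have "u \<in> carrier T \<rightarrow>\<^sub>E {\<zero>\<^bsub>N\<^esub>}" by (auto simp: semimodule_hom_def L_def)
      then show "u = (\<lambda>y\<in>carrier T. \<zero>\<^bsub>L\<^esub>)"
        by (intro extensionalityI[of _ "carrier T"]) (auto simp: PiE_def L_def)
    qed
  qed
  let ?T = "tensor A N M" and ?T' = "tensor A N' M"
  let ?D = "\<lambda>j. tensor A (D j) M"
  let ?F = "\<lambda>f. tensor_map A M (D (Src parallel_pair f)) (D (Tgt parallel_pair f)) (F f)"
  let ?p = "\<lambda>j. tensor_map A M L (D j) (p j)"
  have T: "semimodule A ?T" and T': "semimodule A ?T'"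
    by (simp_all add: semimodule_tensor N N' M)
  interpret T: semimodule A ?T by fact
  interpret T': semimodule A ?T' by fact
  define t where "t j = (if j = 0 then (\<lambda>Y\<in>carrier ?T. Y) else (\<lambda>Y\<in>carrier ?T. \<zero>\<^bsub>?T'\<^esub>))"
    for j :: nat
  have zero_kills: "tensor_map A M N N' (\<lambda>n\<in>carrier N. \<zero>\<^bsub>N'\<^esub>) Y = \<zero>\<^bsub>?T'\<^esub>"
    if "Y \<in> carrier ?T" for Y
  proof -
    obtain y where y: "set_mset y \<subseteq> carrier N \<times> carrier M" "Y = tensor_rel A N M `` {y}"
      using \<open>Y \<in> carrier ?T\<close> by (rule tensor_carrier_cases)
    have mem: "n \<in> carrier N" "m \<in> carrier M" if "(n, m) \<in># y" for n m
      using y(1) that by auto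
    show ?thesis
      unfolding y(2) tensor_map_class[OF N N' M zero_hom[OF N N'] y(1)]
      by (rule tensor_class_eq_zero[OF N' M tensor_rel_empty])
        (auto simp: mem intro!: tensor_rel.zero_left)
  qed
  have cone: "is_cone A parallel_pair ?D ?F ?T t"
    unfolding is_cone_def
  proof (intro conjI)
    show "\<forall>j\<in>Ob parallel_pair. t j \<in> semimodule_hom A ?T (?D j)"
      using identity_hom[OF T] zero_hom[OF T T'] by (simp add: parallel_pair_def t_def D_def)
    show "\<forall>f\<in>Ar parallel_pair.
        compose (carrier ?T) (?F f) (t (Src parallel_pair f)) = t (Tgt parallel_pair f)"
      using kills zero_kills tensor_map_id[OF N M identity_hom[OF N]]
        tensor_map_id[OF N' M identity_hom[OF N'] T'.zero_closed]
      by (auto simp: parallel_pair_def t_def D_def F_def compose_def fun_eq_iff)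
  qed (rule T)
  have "is_limit A parallel_pair ?D ?F (tensor A L M) ?p"
    using flat finite_category_parallel_pair diagram limit unfolding flat_semimodule_def by blast
  \<comment> \<open>The universal arrow \<open>u\<close> factors the identity of \<open>N \<otimes> M\<close> through \<open>0 \<otimes> M\<close>.\<close>
  then have "\<exists>!u. u \<in> semimodule_hom A ?T (tensor A L M) \<and>
      (\<forall>j\<in>Ob parallel_pair. compose (carrier ?T) (?p j) u = t j)"
    unfolding is_limit_def using cone by (elim conjE allE impE)
  then obtain u where u: "u \<in> semimodule_hom A ?T (tensor A L M)"
    and "\<forall>j\<in>Ob parallel_pair. compose (carrier ?T) (?p j) u = t j"
    by (elim ex1E conjE)
  then have pu: "compose (carrier ?T) (?p 0) u = t 0"
    by (simp add: parallel_pair_def)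
  have "u X \<in> carrier (tensor A L M)"
    using u X by (auto simp: semimodule_hom_def)
  then have "u X = \<zero>\<^bsub>tensor A L M\<^esub>"
    by (rule tensor_trivial[OF L M, rotated])
      (use tensor_rel.zero_left[of _ M L A] in \<open>auto simp: L_def\<close>)
  then have "?p 0 \<zero>\<^bsub>tensor A L M\<^esub> = X"
    using compose_eq[OF X, of "?p 0" u] X unfolding pu by (simp add: t_def)
  moreover have "?p 0 \<zero>\<^bsub>tensor A L M\<^esub> = \<zero>\<^bsub>?T\<^esub>"
    using tensor_map_hom[OF L D M p, of 0] by (simp add: semimodule_hom_def D_def)
  ultimately show ?thesis by simp
qed


section \<open>Zerosumfree semirings without zero divisors\<close>

text \<open>The free module of rank one, with its carrier moved into another universe by an
  injection.\<close>

definition free_module_copy ::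
    "('a \<Rightarrow> 'u) \<Rightarrow> ('a, 'r) ring_scheme \<Rightarrow> ('a, 'u) module" where
  "free_module_copy e A =
    \<lparr>carrier = e ` carrier A, monoid.mult = undefined, one = undefined, zero = e \<zero>\<^bsub>A\<^esub>,
     add = (\<lambda>x y. e (inv_into (carrier A) e x \<oplus>\<^bsub>A\<^esub> inv_into (carrier A) e y)),
     smult = (\<lambda>a x. e (a \<otimes>\<^bsub>A\<^esub> inv_into (carrier A) e x))\<rparr>"

text \<open>The module of truth values, with disjunction as addition; the elements \<open>z\<close> and \<open>w\<close> of the
  universe stand for falsity and truth.\<close>

definition bool_module ::
    "'u \<Rightarrow> 'u \<Rightarrow> ('a, 'r) ring_scheme \<Rightarrow> ('a, 'u) module" where
  "bool_module z w A =
    \<lparr>carrier = {z, w}, monoid.mult = undefined, one = undefined,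
     zero = z, add = (\<lambda>x y. if x = z then y else x), smult = (\<lambda>a x. if a = \<zero>\<^bsub>A\<^esub> then z else x)\<rparr>"

lemma semimodule_free_module_copy:
  assumes "csemiring A" and e: "inj_on e (carrier A)"
  shows "semimodule A (free_module_copy e A)"
proof -
  interpret A: csemiring A by fact
  show ?thesis
    unfolding semimodule_def
    by (intro conjI assms(1) abelian_monoidI semimodule_axioms.intro)
      (use e in \<open>auto simp: free_module_copy_def A.a_assoc A.a_comm A.add.m_lcomm A.l_distr
        A.r_distr A.m_assoc intro!: imageI\<close>)
qed

locale zerosumfree_entire = csemiring A for A (structure) +
  assumes one_not_zero: "\<one> \<noteq> \<zero>"
    and zerosumfree: "\<lbrakk>a \<in> carrier A; b \<in> carrier A; a \<oplus> b = \<zero>\<rbrakk> \<Longrightarrow> a = \<zero>"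
    and entire: "\<lbrakk>a \<in> carrier A; b \<in> carrier A; a \<otimes> b = \<zero>\<rbrakk> \<Longrightarrow> a = \<zero> \<or> b = \<zero>"
begin

lemma add_eq_zero_iff:
  "\<lbrakk>a \<in> carrier A; b \<in> carrier A\<rbrakk> \<Longrightarrow> a \<oplus> b = \<zero> \<longleftrightarrow> a = \<zero> \<and> b = \<zero>"
  using zerosumfree by (metis a_comm l_zero zero_closed)

lemma mult_eq_zero_iff:
  "\<lbrakk>a \<in> carrier A; b \<in> carrier A\<rbrakk> \<Longrightarrow> a \<otimes> b = \<zero> \<longleftrightarrow> a = \<zero> \<or> b = \<zero>"
  using entire by auto

lemma semimodule_bool_module: "semimodule A (bool_module z w A)"
  unfolding semimodule_def
  by (intro conjI csemiring_axioms abelian_monoidI semimodule_axioms.intro)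
    (auto simp: bool_module_def add_eq_zero_iff mult_eq_zero_iff one_not_zero)

text \<open>Additivity holds because a sum vanishes only if both summands do, and compatibility with
  scalars because a product vanishes only if one factor does.\<close>

lemma support_hom:
  assumes e: "inj_on e (carrier A)"
  shows "(\<lambda>x\<in>e ` carrier A. if x = e \<zero> then e \<zero> else e \<one>)
    \<in> semimodule_hom A (free_module_copy e A) (bool_module (e \<zero>) (e \<one>) A)"
proof -
  have "e a = e \<zero> \<longleftrightarrow> a = \<zero>" if "a \<in> carrier A" for a
    using e that by (auto dest: inj_onD)
  then show ?thesis
    using e by (auto simp: semimodule_hom_def free_module_copy_def bool_module_def add_eq_zero_iff
        mult_eq_zero_iff)
qed

text \<open>The support map has trivial kernel, but it becomes zero after tensoring with \<open>B\<close>, because its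
  target is idempotent and \<open>B\<close> has additive inverses. If \<open>B\<close> were flat, \<open>A \<otimes> B\<close> would vanish; but
  it contains \<open>1 \<otimes> 1\<close>, which the multiplication map sends to \<open>1 \<noteq> 0\<close>.\<close>

theorem semiring_map_to_ring_not_flat:
  fixes f :: "'a \<Rightarrow> 'c::comm_ring_1" and e :: "'a \<Rightarrow> 'u"
  assumes f: "f \<in> semiring_hom A (semiring_on UNIV)" and e: "inj_on e (carrier A)"
  shows "\<not> flat_semiring_map TYPE('u) A (semiring_on UNIV) f"
proof
  define M where "M = restrict_scalars (semiring_on (UNIV :: 'c set)) f"
  define N where "N = free_module_copy e A"
  define N' where "N' = bool_module (e \<zero>) (e \<one>) A"
  assume "flat_semiring_map TYPE('u) A (semiring_on UNIV) f"
  then have flat: "flat_semimodule TYPE('u) A M" by (simp add: flat_semiring_map_def M_def)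
  have M: "semimodule A M"
    unfolding M_def
    by (rule semimodule_restrict_scalars[OF csemiring_axioms _ f]) (rule csemiring_on; simp)
  have N: "semimodule A N"
    unfolding N_def by (rule semimodule_free_module_copy[OF csemiring_axioms e])
  have N': "semimodule A N'"
    unfolding N'_def by (rule semimodule_bool_module)
  have trivial: "Y = \<zero>\<^bsub>tensor A N' M\<^esub>" if "Y \<in> carrier (tensor A N' M)" for Y
  proof (rule tensor_trivial[OF N' M _ that])
    fix n m assume "n \<in> carrier N'" "m \<in> carrier M"
    then show "({#(n, m)#}, {#}) \<in> tensor_rel A N' M"
      by (intro tensor_rel_idempotent_invertible[OF N' M, of n m "- m"])
        (auto simp: N'_def bool_module_def M_def restrict_scalars_def semiring_on_def)
  qed
  let ?h = "\<lambda>x\<in>e ` carrier A. if x = e \<zero> then e \<zero> else e \<one>"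
  let ?one = "tensor_rel A N M `` {{#(e \<one>, 1)#}}"
  have h: "?h \<in> semimodule_hom A N N'"
    unfolding N_def N'_def by (rule support_hom[OF e])
  have e10: "e \<one> \<noteq> e \<zero>"
    using e one_not_zero by (auto dest: inj_onD)
  have mem: "set_mset {#(e \<one>, 1)#} \<subseteq> carrier N \<times> carrier M"
    by (simp add: N_def free_module_copy_def M_def restrict_scalars_def semiring_on_def)
  have "?one = \<zero>\<^bsub>tensor A N M\<^esub>"
  proof (rule flat_semimodule_trivial_kernel[OF flat M N N' h])
    show "n = \<zero>\<^bsub>N\<^esub>" if "n \<in> carrier N" "?h n = \<zero>\<^bsub>N'\<^esub>" for n
      using that e10
      by (auto simp: N_def N'_def free_module_copy_def bool_module_def split: if_splits)
    show "tensor_map A M N N' ?h X = \<zero>\<^bsub>tensor A N' M\<^esub>" if "X \<in> carrier (tensor A N M)" for X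
      using tensor_map_hom[OF N N' M h] that by (intro trivial) (auto simp: semimodule_hom_def)
    show "?one \<in> carrier (tensor A N M)"
      by (rule tensor_class_closed[OF mem])
  qed
  then have rel: "({#(e \<one>, 1)#}, {#}) \<in> tensor_rel A N M"
    unfolding tensor_zero
    by (rule eq_equiv_class_iff[OF equiv_tensor_rel[OF N M], THEN iffD1, rotated 2])
      (use mem in auto)
  let ?d = "inv_into (carrier A) e"
  have "(\<Sum>(n, m)\<in>#{#(e \<one>, 1)#}. f (?d n) * m) = (\<Sum>(n, m)\<in>#{#}. f (?d n) * m)"
    by (rule tensor_rel_bilinear_invariant[OF rel])
      (use e f in \<open>auto simp: N_def free_module_copy_def M_def restrict_scalars_def
        semiring_on_def semiring_hom_def ring_hom_def algebra_simps\<close>)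
  then show False
    using e f by (simp add: semiring_on_def semiring_hom_def ring_hom_def)
qed

end

lemma zerosumfree_entire_nat: "zerosumfree_entire nat_semiring"
  by (intro zerosumfree_entire.intro csemiring_nat zerosumfree_entire_axioms.intro)
    (auto simp: nat_semiring_def semiring_on_def)

lemma zerosumfree_entire_nonneg_real: "zerosumfree_entire nonneg_real_semiring"
  by (intro zerosumfree_entire.intro csemiring_nonneg_real zerosumfree_entire_axioms.intro)
    (auto simp: nonneg_real_semiring_def semiring_on_def)

theorem corollary1p1p3:
  assumes "infinite (UNIV :: 'u set)"
    and "\<exists>e :: real \<Rightarrow> 'v. inj e"
  shows "\<not> flat_semiring_map TYPE('u) nat_semiring \<Z> int \<and>
    \<not> flat_semiring_map TYPE('v) nonneg_real_semiring real_semiring (\<lambda>x. x)"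
proof
  have int_ring: "\<Z> = semiring_on UNIV" by (simp add: semiring_on_def)
  obtain e :: "nat \<Rightarrow> 'u" where "inj e"
    using assms(1) infinite_countable_subset by blast
  then show "\<not> flat_semiring_map TYPE('u) nat_semiring \<Z> int"
    using zerosumfree_entire.semiring_map_to_ring_not_flat[OF zerosumfree_entire_nat, of int e]
      int_semiring_hom by (auto simp: int_ring intro: inj_on_subset)
  obtain e :: "real \<Rightarrow> 'v" where "inj e"
    using assms(2) by blast
  then show "\<not> flat_semiring_map TYPE('v) nonneg_real_semiring real_semiring (\<lambda>x. x)"
    using zerosumfree_entire.semiring_map_to_ring_not_flat[OF zerosumfree_entire_nonneg_real,
        of "\<lambda>x. x" e] real_semiring_hom
    by (auto simp: real_semiring_def intro: inj_on_subset)
qed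

end
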